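(* Let $P$ be the condensation measure on $\mathbb{R}$ satisfying $P=\frac13 P\circ S_1^{-1}+\frac13 P\circ S_2^{-1}+\frac13\nu$, with $S_1(x)=\frac15x$, $S_2(x)=\frac15x+\frac45$, where $\nu$ is the self-similar probability measure satisfying $\nu=\frac12\nu\circ T_1^{-1}+\frac12\nu\circ T_2^{-1}$ with $T_1(x)=\frac17x+\frac{12}{35}$, $T_2(x)=\frac17x+\frac{18}{35}$. Let $\kappa$ be the unique number with $\left(\frac13\left(\frac15\right)^2\right)^{\frac{\kappa}{2+\kappa}}=\frac12$, i.e. $\kappa=\frac{2\log2}{\log75-\log2}$. Then $D(P)=\max\{\kappa,D(\nu)\}$.
   Context: For a Borel probability measure $\mu$ on $\mathbb{R}$ with compact support, $V_n(\mu)=\inf\{\int\min_{a\in\alpha}(x-a)^2\,d\mu(x):\alpha\subset\mathbb{R},\ 1\le\mathrm{card}(\alpha)\le n\}$ is the $n$th quantization error, and the quantization dimension is $D(\mu)=\lim_{n\to\infty}\frac{2\log n}{-\log V_n(\mu)}$ if the limit exists. Here $D(\nu)=\frac{\log2}{\log7}$. The measures $\nu$ and $P$ are the unique compactly supported Borel probability measures satisfying the displayed identities. *)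

theory Defs
  imports "HOL-Probability.Probability"
begin

definition measure_support :: "'a::topological_space measure \<Rightarrow> 'a set" where
  "measure_support \<mu> = {x. \<forall>U. open U \<longrightarrow> x \<in> U \<longrightarrow> emeasure \<mu> U > 0}"

definition compact_borel_prob :: "real measure \<Rightarrow> bool" where
  "compact_borel_prob \<mu> \<longleftrightarrow>
     prob_space \<mu> \<and> sets \<mu> = sets borel \<and> compact (measure_support \<mu>)"

(* The condition 1 \<le> card \<alpha> also forces \<alpha> to be finite, since infinite sets have
   cardinality 0. For n = 0 the infimum is over the empty set; this value is junk. *)
definition quantization_error :: "nat \<Rightarrow> real measure \<Rightarrow> real" where
  "quantization_error n \<mu> =
     (INF \<alpha> \<in> {\<alpha> :: real set. 1 \<le> card \<alpha> \<and> card \<alpha> \<le> n}.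
        \<integral>x. (MIN a\<in>\<alpha>. (x - a)\<^sup>2) \<partial>\<mu>)"

definition quantization_ratio :: "real measure \<Rightarrow> nat \<Rightarrow> real" where
  "quantization_ratio \<mu> n = 2 * ln (real n) / (- ln (quantization_error n \<mu>))"

(* Meaningful only together with quantization_dim_exists. *)
definition quantization_dim :: "real measure \<Rightarrow> real" where
  "quantization_dim \<mu> = lim (quantization_ratio \<mu>)"

definition quantization_dim_exists :: "real measure \<Rightarrow> bool" where
  "quantization_dim_exists \<mu> \<longleftrightarrow> convergent (quantization_ratio \<mu>)"

end

(* Both measures satisfy mu = p mu f1^-1 + p mu f2^-1 + (1 - 2p) rho for two contractions f1, f2 of
   ratio s with separated images, and for both the quantization error decays like q^k for about 2^k
   points, where q = 2 p s^2; this gives dimension 2 ln 2 / (- ln q), namely ln 2 / ln 7 for nu and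
   kappa for P.
   Lower bound: the 2^k images at level k are separated at scale s^k, so at most half of the mass
   (p^k each) can be close to 2^(k-1) points.
   Upper bound: the images of an optimal set under f1 and f2 together with a quantizer of rho form a
   quantizer of mu. The errors of nu decay by the factor 1/49 < 2/75, so a number of points of order
   2^k suffices for the part nu of P at level k, and about k 2^k points suffice in total. The
   polynomial factor is invisible in the logarithmic limit. *)
theory Submission
  imports Defs "HOL-Real_Asymp.Real_Asymp"
begin

section \<open>Limits of logarithmic ratios\<close>

text \<open>Reading both bounds at the best \<open>k\<close> for a given \<open>n\<close> pins
  \<open>- ln (V n)\<close> to \<open>- ln q\<close> times the binary logarithm of \<open>n\<close>,
  up to an error of order log log n. That error comes from the factor \<open>(k + 1) ^ d\<close> and
  vanishes after division by \<open>ln n\<close>.\<close>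

lemma quantization_limit:
  fixes V :: "nat \<Rightarrow> real"
  assumes c: "0 < c" and C: "0 < C" and q: "0 < q" "q < 1"
    and lower: "\<And>n k. 1 \<le> n \<Longrightarrow> 2 * n \<le> 2 ^ k \<Longrightarrow> c * q ^ k \<le> V n"
    and upper: "\<And>n k. (k + 1) ^ d * 2 ^ k \<le> n \<Longrightarrow> V n \<le> C * q ^ k"
  shows "(\<lambda>n. 2 * ln (real n) / (- ln (V n))) \<longlonglongrightarrow> 2 * ln 2 / (- ln q)"
proof -
  define L where "L = - ln q"
  have L: "L > 0" using q by (simp add: L_def)
  have Vpos: "V n > 0" if "n \<ge> 1" for n
  proof -
    \<comment> \<open>Any admissible exponent would do here; only positivity of \<open>V n\<close>
      is wanted, so that its logarithm is meaningful.\<close>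
    have "2 * n \<le> 2 ^ (2 * n)" by (meson less_exp less_imp_le)
    from lower[OF that this] c q show ?thesis
      by (meson less_le_trans mult_pos_pos zero_less_power)
  qed
  have le: "- ln (V n) \<le> - ln c + (log 2 n + 2) * L" if n: "n \<ge> 1" for n
  proof -
    \<comment> \<open>The ceiling gives \<open>n \<le> 2 ^ (k - 1)\<close> and the added 1 supplies
      the factor 2 demanded by \<open>lower\<close>; together they cost at most 2 in the
      exponent.\<close>
    define k where "k = nat \<lceil>log 2 n\<rceil> + 1"
    have l0: "log 2 n \<ge> 0" using n by simp
    have "real n = 2 powr (log 2 n)" using n by simp
    also have "\<dots> \<le> 2 powr real (nat \<lceil>log 2 n\<rceil>)"
      by (intro powr_mono) (auto intro: real_nat_ceiling_ge)
    also have "\<dots> = 2 ^ nat \<lceil>log 2 n\<rceil>" by (simp add: powr_realpow)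
    finally have "real n \<le> real (2 ^ nat \<lceil>log 2 n\<rceil>)" by simp
    hence "n \<le> 2 ^ nat \<lceil>log 2 n\<rceil>" by (simp only: of_nat_le_iff)
    hence "2 * n \<le> 2 ^ k" by (simp add: k_def)
    from lower[OF n this] have "ln (c * q ^ k) \<le> ln (V n)"
      using c q Vpos[OF n] by simp
    hence "- ln (V n) \<le> - ln c + real k * L"
      using c q by (simp add: ln_mult ln_realpow L_def)
    moreover have "real k \<le> log 2 n + 2" using l0 unfolding k_def by linarith
    ultimately show ?thesis using L mult_right_mono[of "real k" "log 2 n + 2" L] by linarith
  qed
  \<comment> \<open>An approximate inverse, from below, of the point count
    \<open>(j + 1) ^ d * 2 ^ j\<close>: \<open>g n\<close> solves
    \<open>2 powr g n * (log 2 n + 1) ^ d = n\<close>, where \<open>j\<close> in the polynomial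
    factor is replaced by its upper bound \<open>log 2 n\<close>.\<close>
  define g where "g x = log 2 x - real d * log 2 (log 2 x + 1)" for x :: real
  have "filterlim g at_top at_top" unfolding g_def by real_asymp
  hence "eventually (\<lambda>n. g (real n) \<ge> 0) sequentially"
    by (rule filterlim_compose[OF _ filterlim_real_sequentially, THEN filterlim_at_top[THEN iffD1, rule_format]])
  hence ge: "eventually (\<lambda>n. - ln (V n) \<ge> - ln C + (g n - 1) * L) sequentially"
    using eventually_ge_at_top[of 1]
  proof eventually_elim
    case (elim n)
    \<comment> \<open>If \<open>g n\<close> were negative, truncation by \<open>nat\<close> would
      spoil \<open>real j \<le> g n\<close>; hence the restriction to large
      \<open>n\<close>.\<close>
    define j where "j = nat \<lfloor>g n\<rfloor>"
    have l0: "log 2 n \<ge> 0" using elim by simp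
    have j: "real j \<le> g n" "g n - 1 \<le> real j" using elim(1) unfolding j_def by linarith+
    have "g n \<le> log 2 n" using l0 unfolding g_def by simp
    hence j1: "real j + 1 \<le> log 2 n + 1" using j by simp
    have "2 ^ j = 2 powr real j" by (simp add: powr_realpow)
    also have "\<dots> \<le> 2 powr (g n)" using j by (intro powr_mono) auto
    also have "\<dots> = n / (log 2 n + 1) ^ d"
    proof -
      have "2 powr (log 2 (log 2 n + 1) * real d) = (log 2 n + 1) ^ d"
        using l0 by (simp add: powr_realpow flip: powr_powr)
      thus ?thesis using elim by (simp add: g_def powr_diff mult.commute[of "real d"])
    qed
    finally have "2 ^ j * (log 2 n + 1) ^ d \<le> n" using l0 by (simp add: field_simps)
    moreover have "(real j + 1) ^ d \<le> (log 2 n + 1) ^ d" using j1 by (intro power_mono) auto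
    ultimately have "(real j + 1) ^ d * 2 ^ j \<le> n"
      by (smt (verit, best) mult.commute mult_left_mono zero_le_power)
    hence "real ((j + 1) ^ d * 2 ^ j) \<le> real n" by (simp add: add.commute)
    hence "(j + 1) ^ d * 2 ^ j \<le> n" by (simp only: of_nat_le_iff)
    from upper[OF this] have "ln (V n) \<le> ln (C * q ^ j)"
      using C q Vpos elim by simp
    hence "- ln (V n) \<ge> - ln C + real j * L"
      using C q by (simp add: ln_mult ln_realpow L_def)
    with j(2) L mult_right_mono[of "g n - 1" "real j" L] show ?case by linarith
  qed
  have "(\<lambda>n. - ln (V n) / ln (real n)) \<longlonglongrightarrow> L / ln 2"
  proof (rule tendsto_sandwich)
    show "eventually (\<lambda>n. (- ln C + (g n - 1) * L) / ln (real n) \<le> - ln (V n) / ln (real n)) sequentially"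
      using ge eventually_ge_at_top[of 1] by eventually_elim (intro divide_right_mono, auto)
    show "eventually (\<lambda>n. - ln (V n) / ln (real n) \<le> (- ln c + (log 2 n + 2) * L) / ln (real n)) sequentially"
      using eventually_ge_at_top[of 1] by eventually_elim (intro divide_right_mono le, auto)
    have "((\<lambda>x::real. (- ln C + (g x - 1) * L) / ln x) \<longlongrightarrow> inverse (ln 2) * L) at_top"
      unfolding g_def using L by real_asymp
    also have "inverse (ln 2) * L = L / ln 2" by (simp add: field_simps)
    finally have "((\<lambda>x::real. (- ln C + (g x - 1) * L) / ln x) \<longlongrightarrow> L / ln 2) at_top" .
    thus "(\<lambda>n. (- ln C + (g n - 1) * L) / ln (real n)) \<longlonglongrightarrow> L / ln 2"
      by (rule filterlim_compose[OF _ filterlim_real_sequentially])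
    have "((\<lambda>x::real. (- ln c + (log 2 x + 2) * L) / ln x) \<longlongrightarrow> inverse (ln 2) * L) at_top"
      using L by real_asymp
    also have "inverse (ln 2) * L = L / ln 2" by (simp add: field_simps)
    finally have "((\<lambda>x::real. (- ln c + (log 2 x + 2) * L) / ln x) \<longlongrightarrow> L / ln 2) at_top" .
    thus "(\<lambda>n. (- ln c + (log 2 n + 2) * L) / ln (real n)) \<longlonglongrightarrow> L / ln 2"
      by (rule filterlim_compose[OF _ filterlim_real_sequentially])
  qed
  hence "(\<lambda>n. 2 / (- ln (V n) / ln (real n))) \<longlonglongrightarrow> 2 / (L / ln 2)"
    by (rule tendsto_divide[OF tendsto_const]) (use L in simp)
  thus ?thesis by (simp add: L_def)
qed

section \<open>Quantization costs\<close>

lemma closed_far: "closed {x :: real. \<forall>a\<in>\<alpha>. h \<le> \<bar>x - a\<bar>}"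
proof -
  have "closed (\<Inter>a\<in>\<alpha>. {x. h \<le> \<bar>x - a\<bar>})"
    by (intro closed_INT ballI closed_Collect_le continuous_intros)
  moreover have "{x. \<forall>a\<in>\<alpha>. h \<le> \<bar>x - a\<bar>} = (\<Inter>a\<in>\<alpha>. {x. h \<le> \<bar>x - a\<bar>})" by blast
  ultimately show ?thesis by (simp only:)
qed

text \<open>Off the support every point has a null open neighbourhood. By Lindelof's theorem
  countably many of these cover the complement, which is therefore null, and compactness bounds what
  remains.\<close>

lemma compact_support_AE_bounded:
  assumes "compact_borel_prob \<mu>"
  shows "\<exists>B. AE x in \<mu>. \<bar>x\<bar> \<le> B"
proof -
  have sets: "sets \<mu> = sets borel" and "compact (measure_support \<mu>)"
    using assms by (auto simp: compact_borel_prob_def)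
  then obtain B where B: "\<forall>x\<in>measure_support \<mu>. \<bar>x\<bar> \<le> B"
    using compact_imp_bounded bounded_real by metis
  define F where "F = {U :: real set. open U \<and> emeasure \<mu> U = 0}"
  obtain F' where F': "F' \<subseteq> F" "countable F'" "\<Union>F' = \<Union>F"
    using Lindelof[of F] by (auto simp: F_def)
  have "\<Union>F' \<in> null_sets \<mu>"
    using F' by (intro null_sets_UN'[of F' "\<lambda>x. x", simplified]) (auto simp: F_def null_sets_def sets)
  hence "AE x in \<mu>. x \<notin> \<Union>F" unfolding F'(3)[symmetric] by (rule AE_not_in)
  moreover have "\<bar>x\<bar> \<le> B" if "x \<notin> \<Union>F" for x
    using that B zero_less_iff_neq_zero[of "emeasure \<mu> _"]
    unfolding F_def measure_support_def by blast
  ultimately show ?thesis by (metis (mono_tags, lifting) eventually_mono)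
qed

text \<open>Values in \<open>ennreal\<close> keep integrability questions out of the cost recursion;
  \<open>quantization_error_le\<close> returns to the Bochner integral.\<close>

definition quantization_cost :: "real measure \<Rightarrow> real set \<Rightarrow> ennreal" where
  "quantization_cost \<mu> \<alpha> = (\<integral>\<^sup>+x. ennreal (MIN a\<in>\<alpha>. (x - a)\<^sup>2) \<partial>\<mu>)"

lemma Min_sq_dist_nonneg:
  fixes x :: real
  assumes "finite \<alpha>" "\<alpha> \<noteq> {}"
  shows "0 \<le> (MIN a\<in>\<alpha>. (x - a)\<^sup>2)"
  using assms by (subst Min_ge_iff) auto

lemma Min_sq_dist_borel:
  fixes \<alpha> :: "real set"
  assumes "finite \<alpha>" "\<alpha> \<noteq> {}"
  shows "(\<lambda>x. MIN a\<in>\<alpha>. (x - a)\<^sup>2) \<in> borel_measurable borel"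
  using assms
proof (induction rule: finite_ne_induct)
  case (insert a F)
  have "(\<lambda>x. MIN a\<in>insert a F. (x - a)\<^sup>2) = (\<lambda>x. min ((x - a)\<^sup>2) (MIN a\<in>F. (x - a)\<^sup>2))"
    using insert by simp
  moreover have "(\<lambda>x. (x - a)\<^sup>2) \<in> borel_measurable (borel :: real measure)" by measurable
  ultimately show ?case using insert.IH by (simp only: borel_measurable_min)
qed simp

lemma quantization_error_le:
  assumes "sets \<mu> = sets borel" "finite \<alpha>" "\<alpha> \<noteq> {}" "card \<alpha> \<le> n"
    and "quantization_cost \<mu> \<alpha> \<le> ennreal r" "0 \<le> r"
  shows "quantization_error n \<mu> \<le> r"
proof -
  let ?I = "\<lambda>\<alpha>. \<integral>x. (MIN a\<in>\<alpha>. (x - a)\<^sup>2) \<partial>\<mu>"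
  let ?N = "{\<alpha> :: real set. 1 \<le> card \<alpha> \<and> card \<alpha> \<le> n}"
  have N: "finite \<alpha> \<and> \<alpha> \<noteq> {}" if "\<alpha> \<in> ?N" for \<alpha>
    using that card_ge_0_finite[of \<alpha>] by fastforce
  have "bdd_below (?I ` ?N)"
  proof (rule bdd_belowI2)
    fix \<beta> assume "\<beta> \<in> ?N"
    hence "finite \<beta>" "\<beta> \<noteq> {}" using N by blast+
    thus "0 \<le> ?I \<beta>" by (intro Bochner_Integration.integral_nonneg Min_sq_dist_nonneg)
  qed
  moreover have "\<alpha> \<in> ?N" using assms by (simp add: Suc_le_eq card_gt_0_iff)
  ultimately have "quantization_error n \<mu> \<le> ?I \<alpha>"
    unfolding quantization_error_def by (intro cINF_lower)
  also have "?I \<alpha> = enn2real (quantization_cost \<mu> \<alpha>)"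
    unfolding quantization_cost_def
    using Min_sq_dist_borel[of \<alpha>] Min_sq_dist_nonneg[of \<alpha>] assms
    by (intro integral_eq_nn_integral) (auto simp: measurable_cong_sets[OF assms(1) refl])
  also have "\<dots> \<le> r" using assms by (intro enn2real_leI)
  finally show ?thesis .
qed

text \<open>Almost sure boundedness matters: the Bochner integral of a non-integrable function is 0.\<close>
lemma quantization_error_ge:
  assumes "prob_space \<mu>" "sets \<mu> = sets borel" "AE x in \<mu>. \<bar>x\<bar> \<le> B" "1 \<le> n" "0 \<le> h"
    and lower: "\<And>\<alpha>. finite \<alpha> \<Longrightarrow> card \<alpha> \<le> n \<Longrightarrow> w \<le> measure \<mu> {x. \<forall>a\<in>\<alpha>. h \<le> \<bar>x - a\<bar>}"
  shows "h\<^sup>2 * w \<le> quantization_error n \<mu>"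
  unfolding quantization_error_def
proof (rule cINF_greatest)
  have "{0} \<in> {\<alpha> :: real set. 1 \<le> card \<alpha> \<and> card \<alpha> \<le> n}" using assms(4) by simp
  thus "{\<alpha> :: real set. 1 \<le> card \<alpha> \<and> card \<alpha> \<le> n} \<noteq> {}" by blast
next
  interpret prob_space \<mu> by fact
  fix \<alpha> :: "real set" assume \<alpha>: "\<alpha> \<in> {\<alpha>. 1 \<le> card \<alpha> \<and> card \<alpha> \<le> n}"
  hence fin: "finite \<alpha>" "\<alpha> \<noteq> {}" using card.infinite[of \<alpha>] by (cases "finite \<alpha>"; auto)+
  then obtain a0 where a0: "a0 \<in> \<alpha>" by auto
  let ?f = "\<lambda>x. MIN a\<in>\<alpha>. (x - a)\<^sup>2"
  let ?E = "{x. \<forall>a\<in>\<alpha>. h \<le> \<bar>x - a\<bar>}"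
  \<comment> \<open>The distance to the single point \<open>a0\<close> dominates the minimum, so
    boundedness of \<open>x\<close> yields integrability.\<close>
  have "?f x \<le> (x - a0)\<^sup>2" for x using fin a0 by (intro Min_le) auto
  moreover have "(x - a0)\<^sup>2 \<le> (B + \<bar>a0\<bar>)\<^sup>2" if "\<bar>x\<bar> \<le> B" for x
    by (subst abs_le_square_iff[symmetric]) (use that in linarith)
  ultimately have "AE x in \<mu>. norm (?f x) \<le> (B + \<bar>a0\<bar>)\<^sup>2"
    using assms(3) Min_sq_dist_nonneg[OF fin] by (auto elim!: eventually_mono intro: order_trans)
  hence int: "integrable \<mu> ?f"
    using Min_sq_dist_borel[OF fin]
    by (intro integrable_const_bound) (auto simp: measurable_cong_sets[OF assms(2) refl])
  have E: "?E \<in> sets \<mu>" unfolding assms(2) by (intro borel_closed closed_far)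
  \<comment> \<open>Chebyshev's argument: the integrand is at least \<open>h\<^sup>2\<close> on
    \<open>?E\<close> and nonnegative elsewhere.\<close>
  have "h\<^sup>2 * w \<le> h\<^sup>2 * measure \<mu> ?E" using lower[of \<alpha>] \<alpha> fin by (intro mult_left_mono) auto
  also have "\<dots> = (\<integral>x. h\<^sup>2 * indicator ?E x \<partial>\<mu>)" using E by simp
  also have "\<dots> \<le> (\<integral>x. ?f x \<partial>\<mu>)"
  proof (rule integral_mono)
    show "integrable \<mu> (\<lambda>x. h\<^sup>2 * indicator ?E x)" using E by (simp add: emeasure_eq_measure)
    show "h\<^sup>2 * indicator ?E x \<le> ?f x" for x
      using fin assms(5) Min_sq_dist_nonneg[OF fin, of x]
      by (auto simp: indicator_def Min_ge_iff abs_le_square_iff[symmetric])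
  qed (rule int)
  finally show "h\<^sup>2 * w \<le> (\<integral>x. ?f x \<partial>\<mu>)" .
qed

text \<open>Extends an identity between measures of sets to integrals by the standard induction over
  nonnegative measurable functions. It is applied to the two image measures and the inner
  measure.\<close>

lemma nn_integral_three_measures:
  fixes f :: "'a \<Rightarrow> ennreal"
  assumes sets: "sets M1 = sets M" "sets M2 = sets M" "sets M3 = sets M"
    and eq: "\<And>A. A \<in> sets M \<Longrightarrow>
      emeasure M A = c1 * emeasure M1 A + c2 * emeasure M2 A + c3 * emeasure M3 A"
    and f: "f \<in> borel_measurable M"
  shows "(\<integral>\<^sup>+x. f x \<partial>M) =
    c1 * (\<integral>\<^sup>+x. f x \<partial>M1) + c2 * (\<integral>\<^sup>+x. f x \<partial>M2) + c3 * (\<integral>\<^sup>+x. f x \<partial>M3)"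
proof -
  have meas: "g \<in> borel_measurable M1" "g \<in> borel_measurable M2" "g \<in> borel_measurable M3"
    if "g \<in> borel_measurable M" for g :: "'a \<Rightarrow> ennreal"
    using that measurable_cong_sets[OF sets(1) refl, of borel] measurable_cong_sets[OF sets(2) refl, of borel]
      measurable_cong_sets[OF sets(3) refl, of borel] by auto
  show ?thesis
    using f
  proof (induction rule: borel_measurable_induct)
    case (cong f g)
    have "space M1 = space M" "space M2 = space M" "space M3 = space M"
      using sets sets_eq_imp_space_eq by blast+
    hence "integral\<^sup>N N f = integral\<^sup>N N g" if "N \<in> {M, M1, M2, M3}" for N
      using cong that by (intro nn_integral_cong) auto
    hence "integral\<^sup>N M f = integral\<^sup>N M g" "integral\<^sup>N M1 f = integral\<^sup>N M1 g"
      "integral\<^sup>N M2 f = integral\<^sup>N M2 g" "integral\<^sup>N M3 f = integral\<^sup>N M3 g"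
      by blast+
    thus ?case using cong(4) by (simp only:)
  next
    case (set A)
    have "integral\<^sup>N N (indicator A) = emeasure N A" if "N \<in> {M, M1, M2, M3}" for N
      using that set sets by (intro nn_integral_indicator) auto
    hence "integral\<^sup>N M (indicator A) = emeasure M A" "integral\<^sup>N M1 (indicator A) = emeasure M1 A"
      "integral\<^sup>N M2 (indicator A) = emeasure M2 A" "integral\<^sup>N M3 (indicator A) = emeasure M3 A"
      by blast+
    thus ?case using eq[OF set] by (simp only:)
  next
    case (mult u c)
    show ?case unfolding nn_integral_cmult[OF mult(2)] nn_integral_cmult[OF meas(1)[OF mult(2)]]
        nn_integral_cmult[OF meas(2)[OF mult(2)]] nn_integral_cmult[OF meas(3)[OF mult(2)]] mult(4)
      by (simp only: distrib_left mult_ac)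
  next
    case (add u v)
    show ?case unfolding nn_integral_add[OF add(3,1)] nn_integral_add[OF add(3,1)[THEN meas(1)]]
        nn_integral_add[OF add(3,1)[THEN meas(2)]] nn_integral_add[OF add(3,1)[THEN meas(3)]] add(6,7)
      by (simp only: distrib_left add_ac)
  next
    case (seq U)
    have m: "U i \<in> borel_measurable M1" "U i \<in> borel_measurable M2" "U i \<in> borel_measurable M3" for i
      by (rule meas[OF seq(1)])+
    have mc: "integral\<^sup>N N (SUP i. U i) = (SUP i. integral\<^sup>N N (U i))"
      if "\<And>i. U i \<in> borel_measurable N" for N
      unfolding SUP_apply using that by (rule nn_integral_monotone_convergence_SUP[OF seq(3)])
    have inc: "integral\<^sup>N N (U i) \<le> integral\<^sup>N N (U j)" if "i \<le> j" for N i j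
      using incseqD[OF seq(3) that] by (intro nn_integral_mono) (simp add: le_fun_def)
    have "(SUP i. integral\<^sup>N M (U i)) =
        (SUP i. c1 * integral\<^sup>N M1 (U i) + c2 * integral\<^sup>N M2 (U i) + c3 * integral\<^sup>N M3 (U i))"
      unfolding seq(5) by (rule refl)
    \<comment> \<open>Suprema split over the sum because all three sequences are increasing.\<close>
    also have "\<dots> = (SUP i. c1 * integral\<^sup>N M1 (U i)) + (SUP i. c2 * integral\<^sup>N M2 (U i))
        + (SUP i. c3 * integral\<^sup>N M3 (U i))"
      by (subst ennreal_SUP_add; (subst ennreal_SUP_add)?)
        (auto simp: incseq_def intro!: add_mono mult_left_mono inc)
    also have "\<dots> = c1 * (SUP i. integral\<^sup>N M1 (U i)) + c2 * (SUP i. integral\<^sup>N M2 (U i))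
        + c3 * (SUP i. integral\<^sup>N M3 (U i))"
      by (simp only: SUP_mult_left_ennreal)
    finally show ?case
      unfolding mc[OF m(1)] mc[OF m(2)] mc[OF m(3)] mc[OF seq(1)] .
  qed
qed

section \<open>Condensation measures\<close>

text \<open>An upper rate \<open>q\<close> per doubling of the points, with polynomial slack
  \<open>d\<close> in their number. Each condensation step raises \<open>d\<close> by one: 0 for a
  point mass, 1 for \<open>\<nu>\<close>, 2 for \<open>P\<close>.\<close>

definition quantizable :: "real measure \<Rightarrow> nat \<Rightarrow> real \<Rightarrow> bool" where
  "quantizable \<mu> d q \<longleftrightarrow> (\<exists>C\<ge>0. \<forall>k. \<exists>\<alpha>. finite \<alpha> \<and> \<alpha> \<noteq> {} \<and>
     card \<alpha> \<le> (k + 1) ^ d * 2 ^ k \<and> quantization_cost \<mu> \<alpha> \<le> ennreal (C * q ^ k))"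

text \<open>The constant \<open>C = 0\<close> also covers \<open>k = 0\<close>, where
  \<open>0 ^ 0 = 1\<close>. Rate 0 lies below every \<open>q\<close> that occurs.\<close>

lemma quantizable_return: "quantizable (return borel a) 0 0"
  unfolding quantizable_def quantization_cost_def
  by (intro exI[of _ 0] conjI allI exI[of _ "{a}"]) (auto simp: nn_integral_return)

text \<open>A condensation measure \<open>\<mu>\<close> with inner measure \<open>\<rho>\<close>. For \<open>p = 1/2\<close> the weight of \<open>\<rho>\<close>
  vanishes and \<open>\<mu>\<close> is self-similar; any \<open>\<rho>\<close>, such as a point mass, then serves as a dummy.\<close>
locale condensation =
  mu: prob_space \<mu> + rho: prob_space \<rho> for \<mu> \<rho> :: "real measure" +
  fixes p s t\<^sub>1 t\<^sub>2 a b :: real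
  assumes sets_mu: "sets \<mu> = sets borel" and sets_rho: "sets \<rho> = sets borel"
    and p: "0 < p" "p \<le> 1/2" and s: "0 < s" "s < 1"
    and maps: "a \<le> b" "a \<le> s * a + t\<^sub>1" "s * b + t\<^sub>1 < s * a + t\<^sub>2" "s * b + t\<^sub>2 \<le> b"
    and bounded: "\<exists>B. AE x in \<mu>. \<bar>x\<bar> \<le> B"
    and rho_interval: "AE x in \<rho>. x \<in> {a..b}"
    and self_similar: "A \<in> sets borel \<Longrightarrow> measure \<mu> A =
      p * measure \<mu> ((\<lambda>x. s * x + t\<^sub>1) -` A) + p * measure \<mu> ((\<lambda>x. s * x + t\<^sub>2) -` A)
      + (1 - 2 * p) * measure \<rho> A"
begin

text \<open>The factor by which the cost shrinks per level: two copies, each of weight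
  \<open>p\<close>, with squared distances scaled by \<open>s\<^sup>2\<close>.\<close>

definition q :: real where "q = 2 * p * s\<^sup>2"

lemma q_pos: "0 < q" and q_less_1: "q < 1"
proof -
  show "0 < q" using p s by (simp add: q_def)
  have "q \<le> 1 * s\<^sup>2" unfolding q_def using p by (intro mult_right_mono) auto
  also have "\<dots> < 1" using s by (simp add: power_less_one_iff)
  finally show "q < 1" .
qed

section \<open>Localization of the measure in the invariant interval\<close>

lemma vimage_affine_sets: "A \<in> sets borel \<Longrightarrow> (\<lambda>x. s * x + t) -` A \<in> sets borel"
  using measurable_sets_borel[of "\<lambda>x. s * x + t" borel A] by simp

text \<open>A convex combination of three probabilities is 1 when each of them is 1.\<close>

lemma AE_self_similar:
  assumes A: "A \<in> sets borel"
    and "AE x in \<mu>. s * x + t\<^sub>1 \<in> A" "AE x in \<mu>. s * x + t\<^sub>2 \<in> A" "AE x in \<rho>. x \<in> A"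
  shows "AE x in \<mu>. x \<in> A"
proof -
  have "measure \<mu> ((\<lambda>x. s * x + t\<^sub>1) -` A) = 1" "measure \<mu> ((\<lambda>x. s * x + t\<^sub>2) -` A) = 1"
    using vimage_affine_sets[OF A] assms by (auto simp: mu.prob_eq_1 sets_mu)
  moreover have "measure \<rho> A = 1" using assms by (simp add: rho.prob_eq_1 sets_rho)
  ultimately have "measure \<mu> A = 1" using self_similar[OF A] by simp
  thus ?thesis using A by (simp add: mu.prob_eq_1 sets_mu)
qed

text \<open>Both maps send the interval into itself and contract by \<open>s\<close>, so each use of
  self-similarity shrinks the admissible margin around it by \<open>s\<close>. Countably many
  margins can be intersected, and they tend to 0.\<close>

lemma AE_in_interval: "AE x in \<mu>. x \<in> {a..b}"
proof -
  obtain B where B: "AE x in \<mu>. \<bar>x\<bar> \<le> B" using bounded by blast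
  \<comment> \<open>Large enough that the interval with margin \<open>R\<close> contains every
    \<open>x\<close> with \<open>\<bar>x\<bar> \<le> B\<close>.\<close>
  define R where "R = \<bar>B\<bar> + \<bar>a\<bar> + \<bar>b\<bar>"
  have R: "R \<ge> 0" by (simp add: R_def)
  have "AE x in \<mu>. x \<in> {a - R * s ^ k..b + R * s ^ k}" for k
  proof (induction k)
    case 0
    show ?case using B by eventually_elim (auto simp: R_def)
  next
    case (Suc k)
    show ?case
    proof (rule AE_self_similar)
      have mono: "s * x \<ge> s * a - R * s ^ Suc k" "s * x \<le> s * b + R * s ^ Suc k"
        if "x \<in> {a - R * s ^ k..b + R * s ^ k}" for x
        using that s mult_left_mono[of "a - R * s ^ k" x s] mult_left_mono[of x "b + R * s ^ k" s]
        by (auto simp: algebra_simps)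
      have ab: "s * a \<le> s * b" using maps s by simp
      show "AE x in \<mu>. s * x + t\<^sub>1 \<in> {a - R * s ^ Suc k..b + R * s ^ Suc k}"
        using Suc by eventually_elim (use mono ab maps in fastforce)
      show "AE x in \<mu>. s * x + t\<^sub>2 \<in> {a - R * s ^ Suc k..b + R * s ^ Suc k}"
        using Suc by eventually_elim (use mono ab maps in fastforce)
      have "0 \<le> R * s ^ Suc k" using R s by simp
      hence sub: "{a..b} \<subseteq> {a - R * s ^ Suc k..b + R * s ^ Suc k}" by auto
      show "AE x in \<rho>. x \<in> {a - R * s ^ Suc k..b + R * s ^ Suc k}"
        using rho_interval by eventually_elim (use sub in blast)
    qed simp
  qed
  hence "AE x in \<mu>. \<forall>k. x \<in> {a - R * s ^ k..b + R * s ^ k}" by (simp add: AE_all_countable)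
  thus ?thesis
  proof eventually_elim
    case (elim x)
    have "(\<lambda>k. a - R * s ^ k) \<longlonglongrightarrow> a - R * 0" "(\<lambda>k. b + R * s ^ k) \<longlonglongrightarrow> b + R * 0"
      using s by (intro tendsto_intros LIMSEQ_power_zero; simp)+
    with elim have "a - R * 0 \<le> x" "x \<le> b + R * 0"
      by (auto intro: LIMSEQ_le_const LIMSEQ_le_const2)
    thus ?case by simp
  qed
qed

section \<open>Lower bound: mass far from few points\<close>

definition h :: real where "h = ((s * a + t\<^sub>2) - (s * b + t\<^sub>1)) / 2"

lemma h_pos: "0 < h" using maps by (simp add: h_def)

text \<open>A point within \<open>h\<close> of one of the two images of \<open>[a, b]\<close> is not within \<open>h\<close> of the other, so in
  each step of the induction every point of \<open>\<alpha>\<close> is charged to a single half.\<close>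
lemma measure_far_ge:
  assumes "finite \<alpha>"
  shows "(2 ^ k - real (card \<alpha>)) * p ^ k \<le> measure \<mu> {x. \<forall>c\<in>\<alpha>. h * s ^ k \<le> \<bar>x - c\<bar>}"
  using assms
proof (induction k arbitrary: \<alpha>)
  case 0
  show ?case
  proof (cases "\<alpha> = {}")
    case True
    thus ?thesis using mu.prob_space sets_eq_imp_space_eq[OF sets_mu] by simp
  next
    case False
    hence "card \<alpha> \<ge> 1" using 0 by (simp add: Suc_le_eq card_gt_0_iff)
    hence "(2 ^ 0 - real (card \<alpha>)) * p ^ 0 \<le> 0" by simp
    also have "\<dots> \<le> measure \<mu> {x. \<forall>c\<in>\<alpha>. h * s ^ 0 \<le> \<bar>x - c\<bar>}" by simp
    finally show ?thesis .
  qed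
next
  case (Suc k)
  \<comment> \<open>The centre of the gap between the two images of the interval, while
    \<open>h\<close> is half the width of the gap. A point on one side of \<open>m\<close> is thus
    at least \<open>h\<close> away from the image on the other side.\<close>
  define m where "m = ((s * a + t\<^sub>2) + (s * b + t\<^sub>1)) / 2"
  define E where "E = {x. \<forall>c\<in>\<alpha>. h * s ^ Suc k \<le> \<bar>x - c\<bar>}"
  have E: "E \<in> sets borel" unfolding E_def by (intro borel_closed closed_far)
  have small: "h * s ^ Suc k \<le> h" using h_pos s by (simp add: mult_left_le power_le_one flip: power_Suc)
  \<comment> \<open>Only the points \<open>\<gamma>\<close> charged to this half are pulled back to
    the previous level; the others are far from the whole image, since
    \<open>h * s ^ Suc k \<le> h\<close>.\<close>
  have part: "(2 ^ k - real (card \<gamma>)) * p ^ k \<le> measure \<mu> ((\<lambda>x. s * x + t) -` E)"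
    if \<gamma>: "\<gamma> \<subseteq> \<alpha>" and far: "\<And>c x. c \<in> \<alpha> - \<gamma> \<Longrightarrow> x \<in> {a..b} \<Longrightarrow> h \<le> \<bar>s * x + t - c\<bar>" for \<gamma> t
  proof -
    define \<beta> where "\<beta> = (\<lambda>c. (c - t) / s) ` \<gamma>"
    have fin: "finite \<gamma>" using \<gamma> Suc.prems finite_subset by blast
    have "card \<beta> \<le> card \<gamma>" unfolding \<beta>_def by (rule card_image_le[OF fin])
    hence "(2 ^ k - real (card \<gamma>)) * p ^ k \<le> (2 ^ k - real (card \<beta>)) * p ^ k"
      using p by (intro mult_right_mono) auto
    also have "\<dots> \<le> measure \<mu> {x. \<forall>c\<in>\<beta>. h * s ^ k \<le> \<bar>x - c\<bar>}"
      using fin by (intro Suc.IH) (simp add: \<beta>_def)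
    also have "\<dots> \<le> measure \<mu> ((\<lambda>x. s * x + t) -` E)"
    proof (rule mu.finite_measure_mono_AE)
      show "(\<lambda>x. s * x + t) -` E \<in> sets \<mu>" using vimage_affine_sets[OF E] by (simp add: sets_mu)
      show "AE x in \<mu>. x \<in> {x. \<forall>c\<in>\<beta>. h * s ^ k \<le> \<bar>x - c\<bar>} \<longrightarrow> x \<in> (\<lambda>x. s * x + t) -` E"
        using AE_in_interval
      proof eventually_elim
        case (elim x)
        show ?case
        proof
          assume x: "x \<in> {x. \<forall>c\<in>\<beta>. h * s ^ k \<le> \<bar>x - c\<bar>}"
          have "h * s ^ Suc k \<le> \<bar>s * x + t - c\<bar>" if c: "c \<in> \<alpha>" for c
          proof (cases "c \<in> \<gamma>")
            case True
            hence "h * s ^ k \<le> \<bar>x - (c - t) / s\<bar>" using x by (auto simp: \<beta>_def)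
            hence "s * (h * s ^ k) \<le> s * \<bar>x - (c - t) / s\<bar>" using s by (intro mult_left_mono) auto
            also have "\<dots> = \<bar>s * (x - (c - t) / s)\<bar>" using s by (simp add: abs_mult)
            also have "s * (x - (c - t) / s) = s * x + t - c" using s by (simp add: field_simps)
            finally show ?thesis by (simp add: mult_ac)
          next
            case False
            hence "h \<le> \<bar>s * x + t - c\<bar>" using far elim c by blast
            thus ?thesis using small by linarith
          qed
          thus "x \<in> (\<lambda>x. s * x + t) -` E" by (simp add: E_def)
        qed
      qed
    qed
    finally show ?thesis .
  qed
  have sx: "s * a \<le> s * x \<and> s * x \<le> s * b" if "x \<in> {a..b}" for x using that s by auto
  let ?\<alpha>\<^sub>1 = "{c \<in> \<alpha>. c \<le> m}" and ?\<alpha>\<^sub>2 = "{c \<in> \<alpha>. m < c}"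
  have "(2 ^ k - real (card ?\<alpha>\<^sub>1)) * p ^ k \<le> measure \<mu> ((\<lambda>x. s * x + t\<^sub>1) -` E)"
  proof (rule part)
    fix c x assume "c \<in> \<alpha> - ?\<alpha>\<^sub>1" "x \<in> {a..b}"
    hence "m < c" and x: "x \<in> {a..b}" by auto
    hence "h \<le> c - (s * x + t\<^sub>1)" using sx[OF x] unfolding h_def m_def by argo
    thus "h \<le> \<bar>s * x + t\<^sub>1 - c\<bar>" by linarith
  qed auto
  moreover have "(2 ^ k - real (card ?\<alpha>\<^sub>2)) * p ^ k \<le> measure \<mu> ((\<lambda>x. s * x + t\<^sub>2) -` E)"
  proof (rule part)
    fix c x assume "c \<in> \<alpha> - ?\<alpha>\<^sub>2" "x \<in> {a..b}"
    hence "c \<le> m" and x: "x \<in> {a..b}" by auto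
    hence "h \<le> (s * x + t\<^sub>2) - c" using sx[OF x] unfolding h_def m_def by argo
    thus "h \<le> \<bar>s * x + t\<^sub>2 - c\<bar>" by linarith
  qed auto
  ultimately have "p * ((2 ^ k - real (card ?\<alpha>\<^sub>1)) * p ^ k) + p * ((2 ^ k - real (card ?\<alpha>\<^sub>2)) * p ^ k)
      \<le> p * measure \<mu> ((\<lambda>x. s * x + t\<^sub>1) -` E) + p * measure \<mu> ((\<lambda>x. s * x + t\<^sub>2) -` E)"
    using p by (intro add_mono mult_left_mono) auto
  \<comment> \<open>The contribution of \<open>\<rho>\<close> is dropped; its weight is nonnegative
    since \<open>p \<le> 1/2\<close>.\<close>
  also have "\<dots> \<le> measure \<mu> E" using self_similar[OF E] p by simp
  finally have "p * ((2 ^ k - real (card ?\<alpha>\<^sub>1)) * p ^ k) + p * ((2 ^ k - real (card ?\<alpha>\<^sub>2)) * p ^ k) \<le> measure \<mu> E" .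
  moreover have "card \<alpha> = card ?\<alpha>\<^sub>1 + card ?\<alpha>\<^sub>2"
    using Suc.prems by (subst card_Un_disjoint[symmetric]) (auto intro!: arg_cong[of _ _ card])
  ultimately show ?case by (simp add: E_def algebra_simps)
qed

text \<open>With \<open>n\<close> at most half of \<open>2 ^ k\<close>, mass at least
  \<open>2 ^ k / 2 * p ^ k\<close> stays at distance \<open>h * s ^ k\<close>; mass times squared
  distance produces the power of \<open>q\<close>.\<close>

lemma quantization_error_lower:
  assumes "1 \<le> n" "2 * n \<le> 2 ^ k"
  shows "h\<^sup>2 / 2 * q ^ k \<le> quantization_error n \<mu>"
proof -
  obtain B where B: "AE x in \<mu>. \<bar>x\<bar> \<le> B" using bounded by blast
  have "(h * s ^ k)\<^sup>2 * (2 ^ k / 2 * p ^ k) \<le> quantization_error n \<mu>"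
  proof (rule quantization_error_ge[OF mu.prob_space_axioms sets_mu B assms(1)])
    show "0 \<le> h * s ^ k" using h_pos s by simp
    fix \<alpha> :: "real set" assume \<alpha>: "finite \<alpha>" "card \<alpha> \<le> n"
    have "2 * card \<alpha> \<le> 2 ^ k" using \<alpha> assms by linarith
    hence "real (2 * card \<alpha>) \<le> real (2 ^ k)" by (simp only: of_nat_le_iff)
    hence "2 ^ k / 2 * p ^ k \<le> (2 ^ k - real (card \<alpha>)) * p ^ k"
      using p by (intro mult_right_mono) auto
    also note measure_far_ge[OF \<alpha>(1)]
    finally show "2 ^ k / 2 * p ^ k \<le> measure \<mu> {x. \<forall>c\<in>\<alpha>. h * s ^ k \<le> \<bar>x - c\<bar>}" .
  qed
  thus ?thesis by (simp add: q_def power_mult_distrib power_mult[symmetric] mult_ac)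
qed

section \<open>Upper bound: recursive construction of quantizers\<close>

lemma nn_integral_self_similar:
  fixes f :: "real \<Rightarrow> ennreal"
  assumes f: "f \<in> borel_measurable borel"
  shows "(\<integral>\<^sup>+x. f x \<partial>\<mu>) = ennreal p * (\<integral>\<^sup>+x. f (s * x + t\<^sub>1) \<partial>\<mu>)
    + ennreal p * (\<integral>\<^sup>+x. f (s * x + t\<^sub>2) \<partial>\<mu>) + ennreal (1 - 2 * p) * (\<integral>\<^sup>+x. f x \<partial>\<rho>)"
proof -
  have m: "(\<lambda>x. s * x + t) \<in> measurable \<mu> borel" for t
    by (simp add: measurable_cong_sets[OF sets_mu refl])
  have sp: "space \<mu> = UNIV" using sets_eq_imp_space_eq[OF sets_mu] by simp
  have "(\<integral>\<^sup>+x. f x \<partial>\<mu>) = ennreal p * (\<integral>\<^sup>+x. f x \<partial>distr \<mu> borel (\<lambda>x. s * x + t\<^sub>1))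
    + ennreal p * (\<integral>\<^sup>+x. f x \<partial>distr \<mu> borel (\<lambda>x. s * x + t\<^sub>2))
    + ennreal (1 - 2 * p) * (\<integral>\<^sup>+x. f x \<partial>\<rho>)"
  proof (rule nn_integral_three_measures)
    fix A assume "A \<in> sets \<mu>"
    hence A: "A \<in> sets borel" by (simp add: sets_mu)
    show "emeasure \<mu> A = ennreal p * emeasure (distr \<mu> borel (\<lambda>x. s * x + t\<^sub>1)) A
      + ennreal p * emeasure (distr \<mu> borel (\<lambda>x. s * x + t\<^sub>2)) A + ennreal (1 - 2 * p) * emeasure \<rho> A"
      unfolding emeasure_distr[OF m A] sp mu.emeasure_eq_measure rho.emeasure_eq_measure
        self_similar[OF A]
      using p by (simp add: ennreal_mult)
  qed (use f in \<open>simp_all add: sets_mu sets_rho measurable_cong_sets[OF sets_mu refl]\<close>)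
  thus ?thesis by (simp add: nn_integral_distr[OF m] f)
qed

text \<open>On each image the scaled copy of \<open>\<alpha>\<close> serves at
  \<open>s\<^sup>2\<close> times the cost, and \<open>\<beta>\<close> serves the inner part. Points
  of the union beyond these can only lower the cost.\<close>

lemma quantization_cost_step:
  assumes \<alpha>: "finite \<alpha>" "\<alpha> \<noteq> {}" and \<beta>: "finite \<beta>" "\<beta> \<noteq> {}"
  shows "quantization_cost \<mu> ((\<lambda>x. s * x + t\<^sub>1) ` \<alpha> \<union> (\<lambda>x. s * x + t\<^sub>2) ` \<alpha> \<union> \<beta>)
    \<le> ennreal q * quantization_cost \<mu> \<alpha> + ennreal (1 - 2 * p) * quantization_cost \<rho> \<beta>"
proof -
  define \<gamma> where "\<gamma> = (\<lambda>x. s * x + t\<^sub>1) ` \<alpha> \<union> (\<lambda>x. s * x + t\<^sub>2) ` \<alpha> \<union> \<beta>"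
  define F where "F \<alpha> x = ennreal (MIN c\<in>\<alpha>. (x - c)\<^sup>2)" for \<alpha> and x :: real
  have \<gamma>: "finite \<gamma>" "\<gamma> \<noteq> {}" using \<alpha> \<beta> by (auto simp: \<gamma>_def)
  have meas: "F \<delta> \<in> borel_measurable borel" if "finite \<delta>" "\<delta> \<noteq> {}" for \<delta>
    unfolding F_def using Min_sq_dist_borel[OF that] by simp
  have scale: "F \<gamma> (s * x + t) \<le> ennreal (s\<^sup>2) * F \<alpha> x" if t: "(\<lambda>x. s * x + t) ` \<alpha> \<subseteq> \<gamma>" for x t
  proof -
    have "(MIN c\<in>\<alpha>. (x - c)\<^sup>2) \<in> (\<lambda>c. (x - c)\<^sup>2) ` \<alpha>" using \<alpha> by (intro Min_in) auto
    then obtain c where c: "c \<in> \<alpha>" "(MIN c\<in>\<alpha>. (x - c)\<^sup>2) = (x - c)\<^sup>2" by auto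
    have "(MIN c\<in>\<gamma>. (s * x + t - c)\<^sup>2) \<le> (s * x + t - (s * c + t))\<^sup>2"
      using c t \<gamma> by (intro Min_le finite_imageI image_eqI[of _ _ "s * c + t"]) auto
    also have "\<dots> = s\<^sup>2 * (x - c)\<^sup>2" by (simp add: power2_eq_square algebra_simps)
    finally show ?thesis unfolding F_def c(2) by (subst ennreal_mult[symmetric]) (auto intro: ennreal_leI)
  qed
  have "F \<gamma> x \<le> F \<beta> x" for x
    unfolding F_def using \<gamma> \<beta> by (intro ennreal_leI Min_antimono image_mono) (auto simp: \<gamma>_def)
  hence "quantization_cost \<mu> \<gamma> \<le> ennreal p * (\<integral>\<^sup>+x. ennreal (s\<^sup>2) * F \<alpha> x \<partial>\<mu>)
      + ennreal p * (\<integral>\<^sup>+x. ennreal (s\<^sup>2) * F \<alpha> x \<partial>\<mu>) + ennreal (1 - 2 * p) * (\<integral>\<^sup>+x. F \<beta> x \<partial>\<rho>)"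
    unfolding quantization_cost_def F_def[symmetric] nn_integral_self_similar[OF meas[OF \<gamma>]]
    by (intro add_mono mult_left_mono nn_integral_mono scale) (auto simp: \<gamma>_def)
  also have "(\<integral>\<^sup>+x. ennreal (s\<^sup>2) * F \<alpha> x \<partial>\<mu>) = ennreal (s\<^sup>2) * quantization_cost \<mu> \<alpha>"
    unfolding quantization_cost_def F_def[symmetric]
    using meas[OF \<alpha>] by (intro nn_integral_cmult) (simp add: measurable_cong_sets[OF sets_mu refl])
  also have "ennreal p * (ennreal (s\<^sup>2) * quantization_cost \<mu> \<alpha>) + ennreal p * (ennreal (s\<^sup>2) * quantization_cost \<mu> \<alpha>)
      = ennreal q * quantization_cost \<mu> \<alpha>"
  proof -
    have "ennreal q = ennreal p * ennreal (s\<^sup>2) + ennreal p * ennreal (s\<^sup>2)"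
      using p by (simp add: q_def flip: ennreal_mult ennreal_plus)
    thus ?thesis by (simp add: distrib_right mult.assoc)
  qed
  finally show ?thesis by (simp add: \<gamma>_def quantization_cost_def F_def)
qed

text \<open>Since \<open>r < q\<close>, the inner costs form a dominated forcing term and the rate
  \<open>q\<close> survives. The cardinalities double and gain a new term
  \<open>(k + 1) ^ d * 2 ^ k\<close> at each level, which accumulates to one extra factor
  \<open>k + 1\<close>.\<close>

lemma quantizable_step:
  assumes "quantizable \<rho> d r" and r: "0 \<le> r" "r < q"
  shows "quantizable \<mu> (d + 1) q"
proof -
  obtain C where C: "C \<ge> 0" and ex: "\<exists>\<beta>. finite \<beta> \<and> \<beta> \<noteq> {} \<and>
      card \<beta> \<le> (k + 1) ^ d * 2 ^ k \<and> quantization_cost \<rho> \<beta> \<le> ennreal (C * r ^ k)" for k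
    using assms(1) unfolding quantizable_def by auto
  \<comment> \<open>The choice of \<open>M\<close> makes \<open>K q\<^sup>k - M r\<^sup>k\<close> solve the cost recursion exactly.\<close>
  define M where "M = (1 - 2 * p) * C / (q - r)"
  have M: "M \<ge> 0" "M * (q - r) = (1 - 2 * p) * C" using p C r by (auto simp: M_def)
  \<comment> \<open>Makes \<open>K - M\<close> equal to \<open>(b - a)\<^sup>2\<close>, a bound for
    the cost of the single point \<open>a\<close> at level 0.\<close>
  define K where "K = (b - a)\<^sup>2 + M"
  have K: "K \<ge> M" "K \<ge> 0" using M by (auto simp: K_def)
  \<comment> \<open>Needed because \<open>ennreal\<close> sends negative reals to 0, which would
    break the algebra in the induction step.\<close>
  have nonneg: "0 \<le> K * q ^ k - M * r ^ k" for k
    using K M r power_mono[of r q k] q_pos by (simp add: mult_mono)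
  have "\<exists>\<alpha>. finite \<alpha> \<and> \<alpha> \<noteq> {} \<and> card \<alpha> \<le> (k + 1) ^ (d + 1) * 2 ^ k \<and>
      quantization_cost \<mu> \<alpha> \<le> ennreal (K * q ^ k - M * r ^ k)" for k
  proof (induction k)
    case 0
    have "quantization_cost \<mu> {a} \<le> (\<integral>\<^sup>+x. ennreal ((b - a)\<^sup>2) \<partial>\<mu>)"
      unfolding quantization_cost_def
    proof (rule nn_integral_mono_AE)
      show "AE x in \<mu>. ennreal (MIN c\<in>{a}. (x - c)\<^sup>2) \<le> ennreal ((b - a)\<^sup>2)"
        using AE_in_interval by eventually_elim (auto intro!: ennreal_leI power_mono)
    qed
    also have "\<dots> = ennreal (K * q ^ 0 - M * r ^ 0)" by (simp add: K_def mu.emeasure_space_1)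
    finally show ?case by (intro exI[of _ "{a}"]) auto
  next
    case (Suc k)
    then obtain \<alpha> where \<alpha>: "finite \<alpha>" "\<alpha> \<noteq> {}" "card \<alpha> \<le> (k + 1) ^ (d + 1) * 2 ^ k"
      "quantization_cost \<mu> \<alpha> \<le> ennreal (K * q ^ k - M * r ^ k)" by auto
    obtain \<beta> where \<beta>: "finite \<beta>" "\<beta> \<noteq> {}" "card \<beta> \<le> (k + 1) ^ d * 2 ^ k"
      "quantization_cost \<rho> \<beta> \<le> ennreal (C * r ^ k)" using ex[of k] by auto
    define \<gamma> where "\<gamma> = (\<lambda>x. s * x + t\<^sub>1) ` \<alpha> \<union> (\<lambda>x. s * x + t\<^sub>2) ` \<alpha> \<union> \<beta>"
    have "card \<gamma> \<le> card ((\<lambda>x. s * x + t\<^sub>1) ` \<alpha>) + card ((\<lambda>x. s * x + t\<^sub>2) ` \<alpha>) + card \<beta>"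
      unfolding \<gamma>_def by (meson add_le_mono card_Un_le le_refl le_trans)
    also have "\<dots> \<le> card \<alpha> + card \<alpha> + card \<beta>"
      using \<alpha> by (intro add_mono card_image_le) auto
    also have "\<dots> \<le> (k + 1) ^ (d + 1) * 2 ^ k + (k + 1) ^ (d + 1) * 2 ^ k + (k + 1) ^ d * 2 ^ k"
      using \<alpha> \<beta> by (intro add_mono) auto
    \<comment> \<open>This is \<open>2 * (k + 1) + 1 \<le> 2 * (k + 2)\<close> after factoring out
      \<open>(k + 1) ^ d * 2 ^ k\<close>.\<close>
    also have "\<dots> \<le> (k + 1) ^ d * (k + 2) * 2 ^ Suc k" by (simp add: algebra_simps)
    also have "\<dots> \<le> (k + 2) ^ d * (k + 2) * 2 ^ Suc k"
      by (intro mult_right_mono power_mono) auto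
    finally have card: "card \<gamma> \<le> (Suc k + 1) ^ (d + 1) * 2 ^ Suc k" by (simp add: mult_ac)
    have "quantization_cost \<mu> \<gamma> \<le> ennreal q * quantization_cost \<mu> \<alpha> + ennreal (1 - 2 * p) * quantization_cost \<rho> \<beta>"
      unfolding \<gamma>_def by (rule quantization_cost_step[OF \<alpha>(1,2) \<beta>(1,2)])
    also have "\<dots> \<le> ennreal q * ennreal (K * q ^ k - M * r ^ k) + ennreal (1 - 2 * p) * ennreal (C * r ^ k)"
      using \<alpha> \<beta> by (intro add_mono mult_left_mono) auto
    also have "\<dots> = ennreal (q * (K * q ^ k - M * r ^ k) + (1 - 2 * p) * (C * r ^ k))"
      using nonneg[of k] q_pos p C r by (simp add: ennreal_mult ennreal_plus)
    also have "q * (K * q ^ k - M * r ^ k) + (1 - 2 * p) * (C * r ^ k)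
        = q * (K * q ^ k - M * r ^ k) + (M * (q - r)) * r ^ k"
      unfolding M(2) by (simp add: mult.assoc)
    also have "\<dots> = K * q ^ Suc k - M * r ^ Suc k" by (simp add: algebra_simps)
    finally have "quantization_cost \<mu> \<gamma> \<le> ennreal (K * q ^ Suc k - M * r ^ Suc k)" .
    moreover have "finite \<gamma>" "\<gamma> \<noteq> {}" using \<alpha> \<beta> by (auto simp: \<gamma>_def)
    ultimately show ?case using card by blast
  qed
  moreover have "ennreal (K * q ^ k - M * r ^ k) \<le> ennreal (K * q ^ k)" for k
    using M r by (intro ennreal_leI) simp
  ultimately have "\<forall>k. \<exists>\<alpha>. finite \<alpha> \<and> \<alpha> \<noteq> {} \<and> card \<alpha> \<le> (k + 1) ^ (d + 1) * 2 ^ k \<and>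
      quantization_cost \<mu> \<alpha> \<le> ennreal (K * q ^ k)"
    by (meson order_trans)
  with K(2) show ?thesis unfolding quantizable_def by (intro exI[of _ K] conjI)
qed

theorem quantization_ratio_limit:
  assumes "quantizable \<rho> d r" "0 \<le> r" "r < q"
  shows "quantization_ratio \<mu> \<longlonglongrightarrow> 2 * ln 2 / (- ln q)"
proof -
  obtain C where C: "C \<ge> 0" and ex: "\<exists>\<alpha>. finite \<alpha> \<and> \<alpha> \<noteq> {} \<and>
      card \<alpha> \<le> (k + 1) ^ (d + 1) * 2 ^ k \<and> quantization_cost \<mu> \<alpha> \<le> ennreal (C * q ^ k)" for k
    using quantizable_step[OF assms] unfolding quantizable_def by auto
  \<comment> \<open>\<open>quantization_limit\<close> asks for a strictly positive constant, whereas
    \<open>C\<close> may be 0.\<close>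
  have "quantization_error n \<mu> \<le> (C + 1) * q ^ k" if n: "(k + 1) ^ (d + 1) * 2 ^ k \<le> n" for n k
  proof -
    obtain \<alpha> where \<alpha>: "finite \<alpha>" "\<alpha> \<noteq> {}" "card \<alpha> \<le> (k + 1) ^ (d + 1) * 2 ^ k"
      "quantization_cost \<mu> \<alpha> \<le> ennreal (C * q ^ k)" using ex[of k] by auto
    have "quantization_error n \<mu> \<le> C * q ^ k"
      using \<alpha> n C q_pos by (intro quantization_error_le[OF sets_mu]) auto
    also have "\<dots> \<le> (C + 1) * q ^ k" using q_pos by (intro mult_right_mono) auto
    finally show ?thesis .
  qed
  thus ?thesis
    unfolding quantization_ratio_def
    using quantization_limit[of "h\<^sup>2 / 2" "C + 1" q "\<lambda>n. quantization_error n \<mu>" "d + 1"]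
      quantization_error_lower h_pos q_pos q_less_1 C by simp
qed

end

section \<open>The measures \<open>\<nu>\<close> and \<open>P\<close> as instances, and the
  comparison of dimensions\<close>

theorem proposition4p4p3:
  fixes P \<nu> :: "real measure" and S\<^sub>1 S\<^sub>2 T\<^sub>1 T\<^sub>2 :: "real \<Rightarrow> real"
  assumes S1: "S\<^sub>1 = (\<lambda>x. 1/5 * x)"
    and S2: "S\<^sub>2 = (\<lambda>x. 1/5 * x + 4/5)"
    and T1: "T\<^sub>1 = (\<lambda>x. 1/7 * x + 12/35)"
    and T2: "T\<^sub>2 = (\<lambda>x. 1/7 * x + 18/35)"
    and nu: "compact_borel_prob \<nu>"
    and nu_self_similar: "\<forall>A\<in>sets borel. measure \<nu> A =
          1/2 * measure (distr \<nu> borel T\<^sub>1) A + 1/2 * measure (distr \<nu> borel T\<^sub>2) A"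
    and P: "compact_borel_prob P"
    and P_condensation: "\<forall>A\<in>sets borel. measure P A =
          1/3 * measure (distr P borel S\<^sub>1) A + 1/3 * measure (distr P borel S\<^sub>2) A
          + 1/3 * measure \<nu> A"
  shows "(\<exists>!\<kappa>::real. (1/3 * (1/5)\<^sup>2) powr (\<kappa> / (2 + \<kappa>)) = 1/2) \<and>
    (\<forall>\<kappa>::real. (1/3 * (1/5)\<^sup>2) powr (\<kappa> / (2 + \<kappa>)) = 1/2 \<longrightarrow>
       \<kappa> = 2 * ln 2 / (ln 75 - ln 2) \<and>
       quantization_dim_exists \<nu> \<and> quantization_dim_exists P \<and>
       quantization_dim P = max \<kappa> (quantization_dim \<nu>))"
proof -
  have nu_prob: "prob_space \<nu>" "sets \<nu> = sets borel" and P_prob: "prob_space P" "sets P = sets borel"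
    using nu P by (auto simp: compact_borel_prob_def)
  have S1': "S\<^sub>1 = (\<lambda>x. 1/5 * x + 0)" using S1 by simp
  have distr: "measure (distr M borel (\<lambda>x. c * x + t)) A = measure M ((\<lambda>x. c * x + t) -` A)"
    if "sets M = sets borel" "A \<in> sets borel" for M :: "real measure" and c t A
    using that sets_eq_imp_space_eq[OF that(1)]
    by (subst measure_distr) (auto simp: measurable_cong_sets[OF that(1) refl])
  \<comment> \<open>The endpoints 2/5 and 3/5 are the fixed points of \<open>T\<^sub>1\<close> and
    \<open>T\<^sub>2\<close>. The dummy point mass sits at one of them to satisfy
    \<open>rho_interval\<close>.\<close>
  interpret nu: condensation \<nu> "return borel (2/5)" "1/2" "1/7" "12/35" "18/35" "2/5" "3/5"
  proof (rule condensation.intro[OF nu_prob(1) prob_space_return], simp, unfold_locales)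
    show "AE x in return borel (2/5). x \<in> {2/5..3/5::real}" by (subst AE_return) auto
    show "measure \<nu> A = 1/2 * measure \<nu> ((\<lambda>x. 1/7 * x + 12/35) -` A)
        + 1/2 * measure \<nu> ((\<lambda>x. 1/7 * x + 18/35) -` A)
        + (1 - 2 * (1/2)) * measure (return borel (2/5)) A" if "A \<in> sets borel" for A
      using nu_self_similar[rule_format, OF that]
      unfolding T1 T2 distr[OF nu_prob(2) that] by simp
  qed (use nu_prob compact_support_AE_bounded[OF nu] in simp_all)
  \<comment> \<open>Here 0 and 1 are the fixed points of \<open>S\<^sub>1\<close> and
    \<open>S\<^sub>2\<close>, and the interval of \<open>\<nu>\<close> lies between them.\<close>
  interpret P: condensation P \<nu> "1/3" "1/5" 0 "4/5" 0 1
  proof (rule condensation.intro[OF P_prob(1) nu_prob(1)], unfold_locales)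
    show "AE x in \<nu>. x \<in> {0..1}" using nu.AE_in_interval by eventually_elim auto
    show "measure P A = 1/3 * measure P ((\<lambda>x. 1/5 * x + 0) -` A)
        + 1/3 * measure P ((\<lambda>x. 1/5 * x + 4/5) -` A) + (1 - 2 * (1/3)) * measure \<nu> A"
      if "A \<in> sets borel" for A
      using P_condensation[rule_format, OF that]
      unfolding S1' S2 distr[OF P_prob(2) that] by simp
  qed (use P_prob nu_prob compact_support_AE_bounded[OF P] in simp_all)
  have q: "nu.q = 1/49" "P.q = 2/75"
    by (simp_all add: nu.q_def P.q_def power2_eq_square)
  have lim_nu: "quantization_ratio \<nu> \<longlonglongrightarrow> 2 * ln 2 / (- ln (1/49))"
    using nu.quantization_ratio_limit[OF quantizable_return] by (simp add: q)
  \<comment> \<open>The upper rate of \<open>\<nu>\<close> is 1/49, and \<open>1/49 < 2/75\<close>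
    is the required strict inequality \<open>r < q\<close>.\<close>
  have lim_P: "quantization_ratio P \<longlonglongrightarrow> 2 * ln 2 / (- ln (2/75))"
    using P.quantization_ratio_limit[OF nu.quantizable_step[OF quantizable_return]]
    by (simp add: q)
  have D_nu: "quantization_dim \<nu> = 2 * ln 2 / ln 49"
    unfolding quantization_dim_def using limI[OF lim_nu] by (simp add: ln_div)
  have D_P: "quantization_dim P = 2 * ln 2 / (ln 75 - ln 2)"
    unfolding quantization_dim_def using limI[OF lim_P] by (simp add: ln_div)
  have less: "ln 2 < ln (75::real)" by simp
  have "ln (75::real) = ln (2 * (75/2))" by simp
  also have "\<dots> = ln 2 + ln (75/2::real)" by (subst ln_mult) auto
  finally have "ln 75 - ln 2 = ln (75/2::real)" by simp
  \<comment> \<open>The comparison \<open>75/2 \<le> 49\<close> decides that \<open>\<kappa>\<close>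
    is the maximum.\<close>
  also have "\<dots> \<le> ln 49" by simp
  finally have le: "2 * ln 2 / ln 49 \<le> 2 * ln 2 / (ln 75 - ln (2::real))"
    using less by (intro divide_left_mono) auto
  have kappa: "(1/3 * (1/5)\<^sup>2) powr (\<kappa> / (2 + \<kappa>)) = 1/2 \<longleftrightarrow> \<kappa> = 2 * ln 2 / (ln 75 - ln 2)" for \<kappa> :: real
  proof -
    have "(1/3 * (1/5)\<^sup>2) powr (\<kappa> / (2 + \<kappa>)) = 1/2 \<longleftrightarrow>
        ln ((1/75) powr (\<kappa> / (2 + \<kappa>))) = ln (1/2)"
      by (subst ln_inj_iff) (simp_all add: power2_eq_square)
    also have "\<dots> \<longleftrightarrow> \<kappa> / (2 + \<kappa>) * ln 75 = ln 2"
      by (simp add: ln_powr ln_div)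
    also have "\<dots> \<longleftrightarrow> \<kappa> = 2 * ln 2 / (ln 75 - ln 2)"
    \<comment> \<open>At \<open>\<kappa> = -2\<close> division by zero makes the exponent 0, so the
      equation fails there, and the positive closed form is excluded as well.\<close>
    proof (cases "2 + \<kappa> = 0")
      case True
      have "2 * ln 2 / (ln 75 - ln (2::real)) > 0" using less by simp
      moreover have "\<kappa> < 0" using True by simp
      ultimately have "\<kappa> \<noteq> 2 * ln 2 / (ln 75 - ln 2)" by linarith
      thus ?thesis using True by simp
    next
      case False
      thus ?thesis using less by (auto simp: field_simps)
    qed
    finally show ?thesis .
  qed
  have "quantization_dim_exists \<nu>" "quantization_dim_exists P"
    using lim_nu lim_P by (auto simp: quantization_dim_exists_def convergent_def)
  thus ?thesis unfolding kappa D_P D_nu using le by (auto simp: max_def)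
qed

end
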